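(* Let $n\ge 1$, $K\in\{1,\dots,n\}$, $\alpha\in(0,1]$, and $r_i,v_i>0$ for $i\in N=\{1,\dots,n\}$. The cardinality-constrained randomized BMS problem (maximize $R(q)$ over BMS-feasible distributions $q$ on $\mathcal S_K$) is equivalent, preserving feasibility and objective value, to the following problem in rescaled-sales variables $w\in\mathbb R_+^n$: \[ \begin{aligned} \max\quad & F(w):=\frac{\sum_{i} r_iw_i}{1+\sum_i w_i}\\ \text{s.t.}\quad & 0\le w_i\le v_i \quad (i\in N),\\ & \sum_i \frac{w_i}{v_i}\le K,\\ & w_i=0\ \text{ or }\ w_i\ge \alpha\max_{j\in N} w_j\quad (i\in N). \end{aligned} \] That is: (i) for every BMS-feasible distribution $q$ on $\mathcal S_K$, the vector $w$ with $w_i=x_i(q)/x_0(q)$ is feasible for this problem and $F(w)=R(q)$; and (ii) every $w$ feasible for this problem is implemented by some BMS-feasible distribution $q$ on $\mathcal S_K$, and $R(q)=F(w)$. Moreover, when the data $r_i,v_i,\alpha$ are rational, every feasible rational $w$ can be implemented by a rational distribution over $O(n)$ assortments of size at most $K$ (i.e. a distribution $q$ on $\mathcal S_K$ with rational probabilities whose support has at most $Cn$ assortments, where $C$ is an absolute constant).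
   Context: Products $N=\{1,\dots,n\}$; product $i$ has revenue $r_i>0$ and attractiveness $v_i>0$. Under the multinomial-logit (MNL) model, for an assortment $S\subseteq N$ put $d(S)=1+\sum_{i\in S}v_i$; a customer shown $S$ buys product $i$ with probability $\phi_i(S)=v_i\mathbf 1[i\in S]/d(S)$ and buys nothing with probability $\phi_0(S)=1/d(S)$. Let $\mathcal S_K=\{S\subseteq N:|S|\le K\}$ (the empty set is allowed). A randomized policy is a probability distribution $q=(q_S)_{S\in\mathcal S_K}$. It induces $x_i(q)=\sum_{S\in\mathcal S_K} q_S\phi_i(S)$ for $i\in N$, $x_0(q)=\sum_{S\in\mathcal S_K} q_S\phi_0(S)$, and expected revenue $R(q)=\sum_{i\in N} r_ix_i(q)$. The policy is BMS-feasible (balanced market share) if for every $i\in N$, $x_i(q)=0$ or $x_i(q)\ge\alpha\max_{j\in N}x_j(q)$. The rescaled sales of $q$ are $w_i=x_i(q)/x_0(q)$; a policy $q$ implements $w$ if its rescaled sales equal $w$, equivalently $x_i(q)=w_i/(1+\sum_jw_j)$ for all $i\in N$ and $x_0(q)=1/(1+\sum_jw_j)$. *)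

theory Defs
  imports "HOL-Probability.Probability_Mass_Function"
begin

(* Products are the elements of {1..n}.  Revenues, attractiveness values and rescaled sales are
   functions nat => real of which only the values on {1..n} are used. *)

definition instance_data ::
  "nat \<Rightarrow> nat \<Rightarrow> real \<Rightarrow> (nat \<Rightarrow> real) \<Rightarrow> (nat \<Rightarrow> real) \<Rightarrow> bool" where
  "instance_data n K \<alpha> r v \<longleftrightarrow>
     1 \<le> n \<and> 1 \<le> K \<and> K \<le> n \<and> 0 < \<alpha> \<and> \<alpha> \<le> 1 \<and> (\<forall>i\<in>{1..n}. 0 < r i \<and> 0 < v i)"

definition assortments :: "nat \<Rightarrow> nat \<Rightarrow> nat set set" where
  "assortments n K = {S. S \<subseteq> {1..n} \<and> card S \<le> K}"

definition mnl_denom :: "(nat \<Rightarrow> real) \<Rightarrow> nat set \<Rightarrow> real" where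
  "mnl_denom v S = 1 + (\<Sum>i\<in>S. v i)"

definition choice_prob :: "(nat \<Rightarrow> real) \<Rightarrow> nat \<Rightarrow> nat set \<Rightarrow> real" where
  "choice_prob v i S = v i * of_bool (i \<in> S) / mnl_denom v S"

definition no_purchase_prob :: "(nat \<Rightarrow> real) \<Rightarrow> nat set \<Rightarrow> real" where
  "no_purchase_prob v S = 1 / mnl_denom v S"

definition is_policy :: "nat \<Rightarrow> nat \<Rightarrow> nat set pmf \<Rightarrow> bool" where
  "is_policy n K q \<longleftrightarrow> set_pmf q \<subseteq> assortments n K"

definition sales :: "nat \<Rightarrow> nat \<Rightarrow> (nat \<Rightarrow> real) \<Rightarrow> nat set pmf \<Rightarrow> nat \<Rightarrow> real" where
  "sales n K v q i = (\<Sum>S\<in>assortments n K. pmf q S * choice_prob v i S)"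

definition no_sale :: "nat \<Rightarrow> nat \<Rightarrow> (nat \<Rightarrow> real) \<Rightarrow> nat set pmf \<Rightarrow> real" where
  "no_sale n K v q = (\<Sum>S\<in>assortments n K. pmf q S * no_purchase_prob v S)"

definition revenue ::
  "nat \<Rightarrow> nat \<Rightarrow> (nat \<Rightarrow> real) \<Rightarrow> (nat \<Rightarrow> real) \<Rightarrow> nat set pmf \<Rightarrow> real" where
  "revenue n K r v q = (\<Sum>i\<in>{1..n}. r i * sales n K v q i)"

definition balanced :: "nat \<Rightarrow> real \<Rightarrow> (nat \<Rightarrow> real) \<Rightarrow> bool" where
  "balanced n \<alpha> y \<longleftrightarrow> (\<forall>i\<in>{1..n}. y i = 0 \<or> y i \<ge> \<alpha> * Max (y ` {1..n}))"

definition BMS_feasible ::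
  "nat \<Rightarrow> nat \<Rightarrow> real \<Rightarrow> (nat \<Rightarrow> real) \<Rightarrow> nat set pmf \<Rightarrow> bool" where
  "BMS_feasible n K \<alpha> v q \<longleftrightarrow> is_policy n K q \<and> balanced n \<alpha> (sales n K v q)"

definition rescaled_sales ::
  "nat \<Rightarrow> nat \<Rightarrow> (nat \<Rightarrow> real) \<Rightarrow> nat set pmf \<Rightarrow> nat \<Rightarrow> real" where
  "rescaled_sales n K v q i = sales n K v q i / no_sale n K v q"

definition implements ::
  "nat \<Rightarrow> nat \<Rightarrow> (nat \<Rightarrow> real) \<Rightarrow> nat set pmf \<Rightarrow> (nat \<Rightarrow> real) \<Rightarrow> bool" where
  "implements n K v q w \<longleftrightarrow> (\<forall>i\<in>{1..n}. rescaled_sales n K v q i = w i)"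

definition rescaled_objective :: "nat \<Rightarrow> (nat \<Rightarrow> real) \<Rightarrow> (nat \<Rightarrow> real) \<Rightarrow> real" where
  "rescaled_objective n r w = (\<Sum>i\<in>{1..n}. r i * w i) / (1 + (\<Sum>i\<in>{1..n}. w i))"

definition rescaled_feasible ::
  "nat \<Rightarrow> nat \<Rightarrow> real \<Rightarrow> (nat \<Rightarrow> real) \<Rightarrow> (nat \<Rightarrow> real) \<Rightarrow> bool" where
  "rescaled_feasible n K \<alpha> v w \<longleftrightarrow>
     (\<forall>i\<in>{1..n}. 0 \<le> w i \<and> w i \<le> v i) \<and>
     (\<Sum>i\<in>{1..n}. w i / v i) \<le> real K \<and>
     balanced n \<alpha> w"

end

theory Submission
  imports Defs
begin

text \<open>
  Put \<open>y i = w i / v i\<close>. The constraints on \<open>w\<close> say that \<open>y\<close> is a point of the polytope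
  \<open>{y \<in> [0,1]\<^sup>n. \<Sum>i. y i \<le> K}\<close>, whose vertices are the indicators of the sets of size at most
  \<open>K\<close>; so \<open>y = (\<Sum>S. l S * 1\<^sub>S)\<close> for a probability vector \<open>l\<close>. The policy
  \<open>q S = l S * d S / (\<Sum>T. l T * d T)\<close> then has sales proportional to \<open>v i * y i = w i\<close> and no-purchase
  probability proportional to \<open>1\<close>. A greedy decomposition of \<open>y\<close> uses at most \<open>n + 1\<close> sets
  and only subtractions, hence stays rational.
\<close>

section \<open>Greedy decomposition in the cardinality polytope\<close>

text \<open>
  Peel off a set \<open>S\<close> containing every tight coordinate (\<open>y i = t\<close>) and only nonzero ones, with the
  largest weight \<open>\<theta>\<close> that keeps the remainder feasible for \<open>t - \<theta>\<close>. Tight coordinates stay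
  tight, zero coordinates stay zero, and some fractional coordinate becomes tight or zero.
\<close>

lemma cardinality_polytope_decomposition:
  fixes y :: "'a \<Rightarrow> real"
  assumes "finite N" and A: "\<And>a b. a \<in> A \<Longrightarrow> b \<in> A \<Longrightarrow> a - b \<in> A"
    and "0 \<le> t" "t \<in> A" "\<And>i. i \<in> N \<Longrightarrow> 0 \<le> y i \<and> y i \<le> t \<and> y i \<in> A"
    and "(\<Sum>i\<in>N. y i) \<le> real K * t"
  shows "\<exists>l. (\<forall>S. 0 \<le> l S \<and> l S \<in> A) \<and> (\<forall>S. l S \<noteq> 0 \<longrightarrow> S \<subseteq> N \<and> card S \<le> K) \<and>
    (\<Sum>S\<in>Pow N. l S) = t \<and> (\<forall>i\<in>N. (\<Sum>S\<in>Pow N. l S * of_bool (i \<in> S)) = y i) \<and>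
    card {S. l S \<noteq> 0} \<le> card {i\<in>N. 0 < y i \<and> y i < t} + 1"
  using assms(3-)
\<comment> \<open>The measure counts the coordinates that are neither zero nor tight. Peeling a set
  lowers the bound from \<open>t\<close> to \<open>t - \<theta>\<close>, so \<open>t\<close> is
  generalised together with \<open>y\<close>.\<close>
proof (induction "card {i\<in>N. 0 < y i \<and> y i < t}" arbitrary: y t rule: less_induct)
  case less
  note y = less.prems(3) and fin = \<open>finite N\<close>
  \<comment> \<open>Closure under subtraction yields zero as \<open>t - t\<close> and sums as
    \<open>a - (0 - b)\<close>. This lets \<open>A\<close> be the rationals or all reals.\<close>
  have A0: "0 \<in> A" using A[OF less.prems(2) less.prems(2)] by simp
  have A_add: "a + b \<in> A" if "a \<in> A" "b \<in> A" for a b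
    using A[OF that(1) A[OF A0 that(2)]] by simp
  show ?case
  proof (cases "t = 0")
    case True
    then show ?thesis
      using y A0 by (intro exI[of _ "\<lambda>_. 0"]) force
  next
    case False
    with less.prems have t: "0 < t" by simp
    let ?T = "{i\<in>N. y i = t}" and ?P = "{i\<in>N. 0 < y i}"
    \<comment> \<open>Each tight coordinate uses \<open>t\<close> of the budget
      \<open>K * t\<close>, so at most \<open>K\<close> are tight and one admissible set can contain
      them all.\<close>
    have "real (card ?T) * t = (\<Sum>i\<in>?T. y i)" by simp
    also have "\<dots> \<le> (\<Sum>i\<in>N. y i)" using y fin by (intro sum_mono2) auto
    finally have "real (card ?T) * t \<le> real K * t" using less.prems by linarith
    then have T_K: "card ?T \<le> K" using t by simp
    have TP: "?T \<subseteq> ?P" using t by auto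
    then have "card ?T \<le> card ?P" using fin by (intro card_mono) auto
    \<comment> \<open>The size is as large as possible: either \<open>S\<close> has \<open>K\<close>
      elements or it is the whole support. These two cases later give the budget constraint for the
      remainder.\<close>
    then obtain S where S: "?T \<subseteq> S" "S \<subseteq> ?P" "card S = min K (card ?P)"
      using exists_subset_between[of ?T "min K (card ?P)" ?P] T_K TP fin by auto
    have SN: "S \<subseteq> N" and finS: "finite S" and SK: "card S \<le> K"
      using S fin by (auto intro: finite_subset)
    \<comment> \<open>The upper bounds on the weight: \<open>y i\<close> on \<open>S\<close> keeps
      the remainder nonnegative, \<open>t - y i\<close> off \<open>S\<close> keeps it below the
      reduced bound, and \<open>t\<close> is the total mass left.\<close>
    define M where "M = insert t (y ` S \<union> (\<lambda>i. t - y i) ` (N - S))"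
    define \<theta> where "\<theta> = Min M"
    have finM: "finite M" "M \<noteq> {}" using fin finS by (auto simp: M_def)
    have \<theta>M: "\<theta> \<in> M" using finM Min_in by (auto simp: \<theta>_def)
    have MA: "M \<subseteq> A" using y A less.prems(2) SN by (auto simp: M_def)
    \<comment> \<open>Indices in \<open>S\<close> have \<open>y i > 0\<close>, and all tight indices
      lie in \<open>S\<close>, so the slacks off \<open>S\<close> are positive.\<close>
    have pos: "\<forall>x\<in>M. 0 < x" using y S t by (force simp: M_def)
    have \<theta>: "0 < \<theta>" "\<theta> \<in> A" using \<theta>M MA pos by auto
    have le: "\<theta> \<le> x" if "x \<in> M" for x using that finM by (simp add: \<theta>_def)
    have leS: "\<theta> \<le> y i" if "i \<in> S" for i using that by (intro le) (simp add: M_def)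
    have leN: "y i \<le> t - \<theta>" if "i \<in> N" "i \<notin> S" for i
      using le[of "t - y i"] that by (auto simp: M_def)
    have \<theta>t: "\<theta> \<le> t" by (intro le) (simp add: M_def)
    show ?thesis
    proof (cases "\<theta> = t")
      case True
      \<comment> \<open>Using up all the mass forces \<open>y i = t\<close> on \<open>S\<close> and
        \<open>y i = 0\<close> off it, so the single set \<open>S\<close> suffices.\<close>
      have yS: "y i = t * of_bool (i \<in> S)" if "i \<in> N" for i
        using leS[of i] leN[of i] y[of i] that True by (cases "i \<in> S") auto
      show ?thesis
        using SN SK t less.prems(2) A0 fin yS
        by (intro exI[of _ "\<lambda>X. if X = S then t else 0"]) (auto simp: if_distrib if_distribR cong: if_cong)
    next
      case \<theta>_less: False
      define y' where "y' i = y i - \<theta> * of_bool (i \<in> S)" for i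
      let ?F = "{i\<in>N. 0 < y i \<and> y i < t}" and ?F' = "{i\<in>N. 0 < y' i \<and> y' i < t - \<theta>}"
      have "?F' \<subseteq> ?F" using \<theta> by (auto simp: y'_def of_bool_def split: if_splits)
      \<comment> \<open>As \<open>\<theta>\<close> is not \<open>t\<close>, the minimum is attained
        at an index \<open>i\<close>: in \<open>S\<close> it gives \<open>y' i = 0\<close>, off
        \<open>S\<close> it gives \<open>y' i = t - \<theta>\<close>. Either way \<open>i\<close> is
        no longer fractional.\<close>
      moreover have "\<exists>i. i \<in> ?F \<and> i \<notin> ?F'"
        using \<theta>M \<theta>_less \<theta>t \<theta> SN by (force simp: M_def y'_def)
      ultimately have F: "card ?F' < card ?F"
        using fin by (intro psubset_card_mono) auto
      have sum_y': "(\<Sum>i\<in>N. y' i) = (\<Sum>i\<in>N. y i) - real (card S) * \<theta>"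
        using fin SN
        by (simp add: y'_def sum_subtractf of_bool_def if_distrib[of "\<lambda>x. \<theta> * x"] sum.If_cases
            Int_absorb1 cong: if_cong)
      have "(\<Sum>i\<in>N. y' i) \<le> real K * (t - \<theta>)"
      \<comment> \<open>If \<open>S\<close> has \<open>K\<close> elements, the bound falls by
        \<open>K * \<theta>\<close> on both sides. Otherwise \<open>S\<close> is the whole support,
        and fewer than \<open>K\<close> terms remain, each at most
        \<open>t - \<theta>\<close>.\<close>
      proof (cases "card S = K")
        case True
        then show ?thesis using sum_y' less.prems(4) by (simp add: algebra_simps)
      next
        case False
        then have "card S = card ?P" using S(3) by linarith
        then have "S = ?P" using S(2) fin by (intro card_subset_eq) auto
        then have "(\<Sum>i\<in>N. y' i) = (\<Sum>i\<in>S. y' i)"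
          using y fin by (intro sum.mono_neutral_right) (auto simp: y'_def antisym)
        also have "\<dots> \<le> real (card S) * (t - \<theta>)"
          using y SN by (intro sum_bounded_above) (auto simp: y'_def)
        also have "\<dots> \<le> real K * (t - \<theta>)"
          using SK \<theta>t by (intro mult_right_mono) auto
        finally show ?thesis .
      qed
      moreover have "0 \<le> y' i \<and> y' i \<le> t - \<theta> \<and> y' i \<in> A" if "i \<in> N" for i
        using y[OF that] leS[of i] leN[of i] that A \<theta> by (auto simp: y'_def of_bool_def)
      ultimately have "\<exists>l. (\<forall>X. 0 \<le> l X \<and> l X \<in> A) \<and> (\<forall>X. l X \<noteq> 0 \<longrightarrow> X \<subseteq> N \<and> card X \<le> K) \<and>
          (\<Sum>X\<in>Pow N. l X) = t - \<theta> \<and> (\<forall>i\<in>N. (\<Sum>X\<in>Pow N. l X * of_bool (i \<in> X)) = y' i) \<and>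
          card {X. l X \<noteq> 0} \<le> card ?F' + 1"
        using \<theta>t by (intro less.hyps[OF F _ A[OF less.prems(2) \<theta>(2)]]) auto
      then obtain l where l_obj: "\<forall>X. 0 \<le> l X \<and> l X \<in> A" "\<forall>X. l X \<noteq> 0 \<longrightarrow> X \<subseteq> N \<and> card X \<le> K"
        "(\<Sum>X\<in>Pow N. l X) = t - \<theta>" "\<forall>i\<in>N. (\<Sum>X\<in>Pow N. l X * of_bool (i \<in> X)) = y' i"
        "card {X. l X \<noteq> 0} \<le> card ?F' + 1"
        by (elim exE conjE) (rule that)
      note l = l_obj[rule_format]
      \<comment> \<open>The weight is added, not assigned, since \<open>S\<close> may already occur
        in the decomposition of the remainder.\<close>
      define l' where "l' X = l X + (if X = S then \<theta> else 0)" for X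
      have "{X. l' X \<noteq> 0} \<subseteq> insert S {X. l X \<noteq> 0}" by (auto simp: l'_def)
      moreover have finl: "finite {X. l X \<noteq> 0}"
        using l(2) fin by (auto intro: finite_subset[of _ "Pow N"])
      ultimately have "card {X. l' X \<noteq> 0} \<le> Suc (card {X. l X \<noteq> 0})"
        by (metis card_mono card_insert_disjoint finite.insertI insert_absorb le_SucI)
      then have "card {X. l' X \<noteq> 0} \<le> card ?F + 1" using l(5) F by linarith
      moreover have "(\<Sum>X\<in>Pow N. l' X) = t"
        using l(3) fin SN by (simp add: l'_def sum.distrib)
      moreover have "(\<Sum>X\<in>Pow N. l' X * of_bool (i \<in> X)) = y i" if "i \<in> N" for i
      proof -
        have "(\<Sum>X\<in>Pow N. l' X * of_bool (i \<in> X)) =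
            (\<Sum>X\<in>Pow N. l X * of_bool (i \<in> X) + (if X = S then \<theta> * of_bool (i \<in> S) else 0))"
          by (intro sum.cong) (auto simp: l'_def)
        also have "\<dots> = y i"
          using l(4)[OF that] fin SN by (simp only: sum.distrib) (simp add: y'_def)
        finally show ?thesis .
      qed
      moreover have "0 \<le> l' X \<and> l' X \<in> A" for X
        using l(1)[of X] \<theta> A_add[of "l X" \<theta>] by (auto simp: l'_def)
      moreover have "X \<subseteq> N \<and> card X \<le> K" if "l' X \<noteq> 0" for X
        using that l(2)[of X] SN SK by (auto simp: l'_def split: if_splits)
      ultimately show ?thesis by (intro exI[of _ l']) blast
    qed
  qed
qed

section \<open>Balance condition and assortments\<close>

lemma balanced_iff:
  assumes "1 \<le> n" "0 < \<alpha>"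
  shows "balanced n \<alpha> y \<longleftrightarrow> (\<forall>i\<in>{1..n}. y i = 0 \<or> (\<forall>j\<in>{1..n}. \<alpha> * y j \<le> y i))"
proof -
  have "\<alpha> * Max (y ` {1..n}) \<le> c \<longleftrightarrow> (\<forall>j\<in>{1..n}. \<alpha> * y j \<le> c)" for c
  proof -
    have "\<alpha> * Max (y ` {1..n}) \<le> c \<longleftrightarrow> Max (y ` {1..n}) \<le> c / \<alpha>"
      using assms by (simp add: field_simps)
    also have "\<dots> \<longleftrightarrow> (\<forall>j\<in>{1..n}. y j \<le> c / \<alpha>)"
      using assms by (subst Max_le_iff) auto
    also have "\<dots> \<longleftrightarrow> (\<forall>j\<in>{1..n}. \<alpha> * y j \<le> c)"
      using assms by (simp add: field_simps)
    finally show ?thesis .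
  qed
  then show ?thesis by (simp add: balanced_def)
qed

text \<open>Balance is homogeneous, so it passes between sales and rescaled sales, which differ by
  the factor \<open>no_sale\<close>.\<close>

lemma balanced_divide_iff:
  assumes "1 \<le> n" "0 < \<alpha>" "0 < c"
  shows "balanced n \<alpha> (\<lambda>i. y i / c) \<longleftrightarrow> balanced n \<alpha> y"
  using assms by (simp add: balanced_iff divide_le_cancel)

lemma finite_assortments [simp]: "finite (assortments n K)"
  by (rule finite_subset[of _ "Pow {1..n}"]) (auto simp: assortments_def)

lemma mnl_denom_pos:
  assumes "\<forall>i\<in>{1..n}. 0 < v i" "S \<in> assortments n K"
  shows "0 < mnl_denom v S"
proof -
  have "0 \<le> (\<Sum>i\<in>S. v i)" using assms by (intro sum_nonneg) (force simp: assortments_def)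
  then show ?thesis by (simp add: mnl_denom_def)
qed

section \<open>From a policy to its rescaled sales\<close>

context
  fixes n K :: nat and v :: "nat \<Rightarrow> real" and q :: "nat set pmf"
  assumes v: "\<forall>i\<in>{1..n}. 0 < v i" and q: "is_policy n K q"
begin

lemma sum_pmf_policy: "(\<Sum>S\<in>assortments n K. pmf q S) = 1"
  using q by (intro sum_pmf_eq_1) (auto simp: is_policy_def)

lemma no_sale_pos: "0 < no_sale n K v q"
proof -
  have "\<exists>S\<in>assortments n K. 0 < pmf q S"
    using q set_pmf_not_empty[of q] by (force simp: is_policy_def pmf_positive_iff)
  then show ?thesis
    unfolding no_sale_def no_purchase_prob_def
    using mnl_denom_pos[OF v] by (fastforce intro: sum_pos2)
qed

text \<open>For each assortment the purchase and no-purchase probabilities sum to one; averaging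
  over \<open>q\<close> preserves this.\<close>

lemma no_sale_plus_sales: "no_sale n K v q + (\<Sum>i\<in>{1..n}. sales n K v q i) = 1"
proof -
  have "(\<Sum>i\<in>{1..n}. choice_prob v i S) + no_purchase_prob v S = 1" if "S \<in> assortments n K" for S
  proof -
    have "(\<Sum>i\<in>{1..n}. v i * of_bool (i \<in> S)) = (\<Sum>i\<in>S. v i)"
      using that by (intro sum.mono_neutral_cong_right) (auto simp: assortments_def)
    then show ?thesis
      using mnl_denom_pos[OF v that]
      by (simp add: choice_prob_def no_purchase_prob_def sum_divide_distrib[symmetric]
          add_divide_distrib[symmetric]) (simp add: mnl_denom_def)
  qed
  then have "1 = (\<Sum>S\<in>assortments n K.
      pmf q S * ((\<Sum>i\<in>{1..n}. choice_prob v i S) + no_purchase_prob v S))"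
    using sum_pmf_policy by simp
  also have "\<dots> = no_sale n K v q + (\<Sum>i\<in>{1..n}. sales n K v q i)"
    unfolding no_sale_def sales_def
    by (subst sum.swap) (simp add: distrib_left sum.distrib sum_distrib_left)
  finally show ?thesis by simp
qed

text \<open>Both bounds hold assortment by assortment, as a choice probability is \<open>v i\<close>
  times the no-purchase probability or zero. Dividing by \<open>no_sale\<close> turns them into
  \<open>0 \<le> w i \<le> v i\<close>.\<close>

lemma sales_bounds:
  assumes "i \<in> {1..n}"
  shows "0 \<le> sales n K v q i" "sales n K v q i \<le> v i * no_sale n K v q"
proof -
  show "0 \<le> sales n K v q i"
    using v assms mnl_denom_pos[OF v] unfolding sales_def choice_prob_def
    by (intro sum_nonneg) (simp add: less_imp_le)
  show "sales n K v q i \<le> v i * no_sale n K v q"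
    unfolding sales_def no_sale_def choice_prob_def no_purchase_prob_def sum_distrib_left
    using v assms mnl_denom_pos[OF v] by (intro sum_mono) (simp add: less_imp_le mult.commute)
qed

text \<open>Dividing by \<open>v i\<close> leaves the indicator of \<open>i \<in> S\<close> over
  \<open>mnl_denom v S\<close>; summing over \<open>i\<close> counts \<open>S\<close>, which has at
  most \<open>K\<close> elements.\<close>

lemma sum_sales_le: "(\<Sum>i\<in>{1..n}. sales n K v q i / v i) \<le> real K * no_sale n K v q"
proof -
  have "(\<Sum>i\<in>{1..n}. sales n K v q i / v i) =
      (\<Sum>S\<in>assortments n K. pmf q S * ((\<Sum>i\<in>{1..n}. of_bool (i \<in> S)) / mnl_denom v S))"
    unfolding sales_def choice_prob_def sum_divide_distrib sum_distrib_left
    using v by (subst sum.swap) (force intro!: sum.cong)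
  also have "\<dots> \<le> (\<Sum>S\<in>assortments n K. pmf q S * (real K / mnl_denom v S))"
  proof (intro sum_mono mult_left_mono divide_right_mono)
    fix S assume S: "S \<in> assortments n K"
    then have "(\<Sum>i\<in>{1..n}. of_bool (i \<in> S)) = real (card S)"
      by (simp add: assortments_def Int_absorb1 flip: Int_def)
    then show "(\<Sum>i\<in>{1..n}. of_bool (i \<in> S)) \<le> real K"
      using S by (simp add: assortments_def)
    show "0 \<le> mnl_denom v S" using mnl_denom_pos[OF v S] by simp
  qed simp
  also have "\<dots> = real K * no_sale n K v q"
    by (simp add: no_sale_def no_purchase_prob_def sum_distrib_left mult.commute)
  finally show ?thesis .
qed

lemma rescaled_objective_rescaled_sales:
  "rescaled_objective n r (rescaled_sales n K v q) = revenue n K r v q"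
proof -
  let ?z = "no_sale n K v q"
  \<comment> \<open>The denominator of the objective is \<open>1 / ?z\<close>, which cancels the
    \<open>1 / ?z\<close> in the numerator.\<close>
  have "1 + (\<Sum>i\<in>{1..n}. sales n K v q i / ?z) = 1 / ?z"
    using no_sale_pos no_sale_plus_sales by (simp add: sum_divide_distrib[symmetric] field_simps)
  then show ?thesis
    using no_sale_pos
    by (simp add: rescaled_objective_def rescaled_sales_def revenue_def sum_divide_distrib[symmetric])
qed

lemma rescaled_feasible_rescaled_sales:
  assumes "1 \<le> n" "0 < \<alpha>" "balanced n \<alpha> (sales n K v q)"
  shows "rescaled_feasible n K \<alpha> v (rescaled_sales n K v q)"
proof -
  have "(\<Sum>i\<in>{1..n}. rescaled_sales n K v q i / v i) =
      (\<Sum>i\<in>{1..n}. sales n K v q i / v i) / no_sale n K v q"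
    by (simp add: rescaled_sales_def sum_divide_distrib mult.commute)
  then show ?thesis
    using sum_sales_le sales_bounds no_sale_pos assms balanced_divide_iff[OF assms(1,2) no_sale_pos]
    by (auto simp: rescaled_feasible_def rescaled_sales_def[abs_def] pos_divide_le_eq)
qed

end

section \<open>From rescaled sales to an implementing policy\<close>

lemma exists_implementing_policy:
  assumes "1 \<le> n" and v: "\<forall>i\<in>{1..n}. 0 < v i" and w: "rescaled_feasible n K \<alpha> v w"
  shows "\<exists>q. is_policy n K q \<and> implements n K v q w \<and> card (set_pmf q) \<le> n + 1 \<and>
    ((\<forall>i\<in>{1..n}. v i \<in> \<rat> \<and> w i \<in> \<rat>) \<longrightarrow> (\<forall>S. pmf q S \<in> \<rat>))"
proof -
  \<comment> \<open>Choosing the coefficient set by cases lets one construction serve both arbitrary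
    real data and rational data.\<close>
  define Q :: "real set" where "Q = (if \<forall>i\<in>{1..n}. v i \<in> \<rat> \<and> w i \<in> \<rat> then \<rat> else UNIV)"
  let ?N = "{1..n}" and ?A = "assortments n K"
  have w_bounds: "0 \<le> w i" "w i \<le> v i" if "i \<in> ?N" for i
    using w that by (auto simp: rescaled_feasible_def)
  have "\<exists>l. (\<forall>S. 0 \<le> l S \<and> l S \<in> Q) \<and> (\<forall>S. l S \<noteq> 0 \<longrightarrow> S \<subseteq> ?N \<and> card S \<le> K) \<and>
    (\<Sum>S\<in>Pow ?N. l S) = 1 \<and> (\<forall>i\<in>?N. (\<Sum>S\<in>Pow ?N. l S * of_bool (i \<in> S)) = w i / v i) \<and>
    card {S. l S \<noteq> 0} \<le> card {i\<in>?N. 0 < w i / v i \<and> w i / v i < 1} + 1"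
  proof (rule cardinality_polytope_decomposition)
    show "0 \<le> w i / v i \<and> w i / v i \<le> 1 \<and> w i / v i \<in> Q" if "i \<in> ?N" for i
      using w_bounds[OF that] v that by (auto simp: Q_def)
    show "(\<Sum>i\<in>?N. w i / v i) \<le> real K * 1"
      using w by (simp add: rescaled_feasible_def)
  qed (auto simp: Q_def split: if_splits)
  then obtain l where l_obj: "\<forall>S. 0 \<le> l S \<and> l S \<in> Q" "\<forall>S. l S \<noteq> 0 \<longrightarrow> S \<subseteq> ?N \<and> card S \<le> K"
    "(\<Sum>S\<in>Pow ?N. l S) = 1" "\<forall>i\<in>?N. (\<Sum>S\<in>Pow ?N. l S * of_bool (i \<in> S)) = w i / v i"
    "card {S. l S \<noteq> 0} \<le> card {i\<in>?N. 0 < w i / v i \<and> w i / v i < 1} + 1"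
    by (elim exE conjE) (rule that)
  note l = l_obj[rule_format]
  have sum_l: "(\<Sum>S\<in>Pow ?N. l S * f S) = (\<Sum>S\<in>?A. l S * f S)" for f :: "nat set \<Rightarrow> real"
    using l(2) by (intro sum.mono_neutral_right) (auto simp: assortments_def)
  have l_1: "(\<Sum>S\<in>?A. l S) = 1" using l(3) sum_l[of "\<lambda>_. 1"] by simp
  have l_y: "(\<Sum>S\<in>?A. l S * of_bool (i \<in> S)) = w i / v i" if "i \<in> ?N" for i
    using l(4)[OF that] sum_l[of "\<lambda>S. of_bool (i \<in> S)"] by linarith
  have l_supp: "S \<in> ?A" if "l S \<noteq> 0" for S using l(2)[OF that] by (simp add: assortments_def)
  \<comment> \<open>The normalising constant, shown below to equal the sum of
    \<open>l S * mnl_denom v S\<close>; in this form its rationality is immediate.\<close>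
  define Z where "Z = 1 + (\<Sum>i\<in>?N. w i)"
  have Z: "0 < Z" using w_bounds sum_nonneg[of ?N w] by (simp add: Z_def)
  define f where "f S = l S * mnl_denom v S / Z" for S
  have "0 \<le> f S \<and> (f S = 0 \<longleftrightarrow> l S = 0)" for S
  proof (cases "l S = 0")
    case False
    then have "0 < mnl_denom v S" using mnl_denom_pos[OF v l_supp] by blast
    then show ?thesis using Z l(1)[of S] by (simp add: f_def)
  qed (simp add: f_def)
  then have f_nonneg: "\<And>S. 0 \<le> f S" and f_0_iff: "\<And>S. f S = 0 \<longleftrightarrow> l S = 0" by auto
  \<comment> \<open>After expanding the denominators and swapping sums, product \<open>i\<close>
    contributes \<open>v i\<close> times its coverage \<open>w i / v i\<close>, that is
    \<open>w i\<close>.\<close>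
  have "(\<Sum>S\<in>?A. l S * mnl_denom v S) = (\<Sum>S\<in>?A. l S + (\<Sum>i\<in>?N. v i * (l S * of_bool (i \<in> S))))"
  proof (intro sum.cong refl)
    fix S assume "S \<in> ?A"
    then have "(\<Sum>i\<in>?N. v i * (l S * of_bool (i \<in> S))) = (\<Sum>i\<in>S. l S * v i)"
      by (intro sum.mono_neutral_cong_right) (auto simp: assortments_def)
    then show "l S * mnl_denom v S = l S + (\<Sum>i\<in>?N. v i * (l S * of_bool (i \<in> S)))"
      by (simp add: mnl_denom_def distrib_left sum_distrib_left)
  qed
  also have "\<dots> = 1 + (\<Sum>i\<in>?N. \<Sum>S\<in>?A. v i * (l S * of_bool (i \<in> S)))"
    using l_1 by (subst sum.swap) (simp only: sum.distrib)
  also have "\<dots> = 1 + (\<Sum>i\<in>?N. v i * (w i / v i))"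
    using l_y by (simp only: flip: sum_distrib_left cong: sum.cong)
  also have "\<dots> = Z"
    unfolding Z_def using v by (intro arg_cong2[of _ _ _ _ "(+)"] sum.cong refl) force
  finally have "(\<Sum>S\<in>?A. f S) = 1"
    using Z by (simp add: f_def flip: sum_divide_distrib)
  \<comment> \<open>\<open>embed_pmf\<close> asks for total mass one over all sets of naturals;
    \<open>f\<close> vanishes off the assortments, so a finite sum remains.\<close>
  moreover have "(\<integral>\<^sup>+S. ennreal (f S) \<partial>count_space UNIV) = (\<Sum>S\<in>?A. ennreal (f S))"
  proof (intro nn_integral_count_space')
    show "ennreal (f S) = 0" if "S \<notin> ?A" for S
      using that l_supp[of S] f_0_iff[of S] by fastforce
  qed simp_all
  ultimately have "(\<integral>\<^sup>+S. ennreal (f S) \<partial>count_space UNIV) = 1"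
    using f_nonneg by (simp add: sum_ennreal)
  note pmf_f = pmf_embed_pmf[OF f_nonneg this] and set_f = set_embed_pmf[OF f_nonneg this]
  define q where "q = embed_pmf f"
  have q: "pmf q S = f S" "set_pmf q = {S. l S \<noteq> 0}" for S
    using pmf_f set_f f_0_iff by (auto simp: q_def)
  have no_sale: "no_sale n K v q = 1 / Z"
  proof -
    have "no_sale n K v q = (\<Sum>S\<in>?A. l S * 1 / Z)"
      unfolding no_sale_def q no_purchase_prob_def f_def
      using mnl_denom_pos[OF v] by (force intro!: sum.cong)
    then show ?thesis using l_1 by (simp flip: sum_divide_distrib)
  qed
  have sales: "sales n K v q i = w i / Z" if "i \<in> ?N" for i
  proof -
    have "sales n K v q i = (\<Sum>S\<in>?A. v i * (l S * of_bool (i \<in> S)) / Z)"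
      unfolding sales_def q choice_prob_def f_def
      using mnl_denom_pos[OF v] by (force intro!: sum.cong)
    also have "\<dots> = v i * (w i / v i) / Z"
      using l_y[OF that] by (simp only: flip: sum_divide_distrib sum_distrib_left)
    also have "\<dots> = w i / Z" using v that by force
    finally show ?thesis .
  qed
  have "is_policy n K q" using l_supp q by (auto simp: is_policy_def)
  moreover have "implements n K v q w"
    using sales no_sale Z by (simp add: implements_def rescaled_sales_def)
  moreover have "card (set_pmf q) \<le> n + 1"
  proof -
    \<comment> \<open>At most \<open>n\<close> coordinates are fractional; the extra one is the last
      set peeled.\<close>
    have "card {i\<in>?N. 0 < w i / v i \<and> w i / v i < 1} \<le> card ?N" by (intro card_mono) auto
    then show ?thesis using l(5) q by simp
  qed
  moreover have "pmf q S \<in> \<rat>" if rat: "\<forall>i\<in>?N. v i \<in> \<rat> \<and> w i \<in> \<rat>" for S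
  proof (cases "l S = 0")
    case True
    then show ?thesis by (simp add: q f_def)
  next
    case False
    have "mnl_denom v S \<in> \<rat>" unfolding mnl_denom_def
      using l(2)[OF False] rat by (intro Rats_add Rats_1 Rats_sum) auto
    moreover have "Z \<in> \<rat>" unfolding Z_def using rat by (intro Rats_add Rats_1 Rats_sum) auto
    moreover have "l S \<in> \<rat>" using l(1)[of S] rat by (simp add: Q_def)
    ultimately show ?thesis by (simp add: q f_def)
  qed
  ultimately show ?thesis by blast
qed

lemma implements_imp_rescaled_objective_eq:
  assumes "implements n K v q w"
  shows "rescaled_objective n r (rescaled_sales n K v q) = rescaled_objective n r w"
  using assms by (simp add: implements_def rescaled_objective_def)

text \<open>Balance reads only the values on \<open>{1..n}\<close>, where \<open>w\<close> agrees
  with the rescaled sales; homogeneity then carries it to the sales.\<close>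

lemma implements_imp_BMS_feasible:
  assumes "1 \<le> n" "0 < \<alpha>" "\<forall>i\<in>{1..n}. 0 < v i"
    and "is_policy n K q" "implements n K v q w" "balanced n \<alpha> w"
  shows "BMS_feasible n K \<alpha> v q"
proof -
  have "balanced n \<alpha> (rescaled_sales n K v q)"
    using assms by (simp add: balanced_iff implements_def)
  then have "balanced n \<alpha> (sales n K v q)"
    using balanced_divide_iff[OF assms(1,2) no_sale_pos[OF assms(3,4)]]
    by (simp add: rescaled_sales_def[abs_def])
  then show ?thesis using assms by (simp add: BMS_feasible_def)
qed

theorem theorem1:
  "(\<forall>(n::nat) (K::nat) (\<alpha>::real) (r::nat \<Rightarrow> real) (v::nat \<Rightarrow> real).
      instance_data n K \<alpha> r v \<longrightarrow>
        (\<forall>q. BMS_feasible n K \<alpha> v q \<longrightarrow>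
           rescaled_feasible n K \<alpha> v (rescaled_sales n K v q) \<and>
           rescaled_objective n r (rescaled_sales n K v q) = revenue n K r v q) \<and>
        (\<forall>w. rescaled_feasible n K \<alpha> v w \<longrightarrow>
           (\<exists>q. BMS_feasible n K \<alpha> v q \<and> implements n K v q w \<and>
                revenue n K r v q = rescaled_objective n r w))) \<and>
   (\<exists>C::nat. \<forall>(n::nat) (K::nat) (\<alpha>::real) (r::nat \<Rightarrow> real) (v::nat \<Rightarrow> real) (w::nat \<Rightarrow> real).
      instance_data n K \<alpha> r v \<longrightarrow>
      \<alpha> \<in> \<rat> \<longrightarrow> (\<forall>i\<in>{1..n}. r i \<in> \<rat> \<and> v i \<in> \<rat>) \<longrightarrow>
      rescaled_feasible n K \<alpha> v w \<longrightarrow> (\<forall>i\<in>{1..n}. w i \<in> \<rat>) \<longrightarrow>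
        (\<exists>q. is_policy n K q \<and> implements n K v q w \<and>
             (\<forall>S. pmf q S \<in> \<rat>) \<and> card (set_pmf q) \<le> C * n))"
proof (intro conjI allI impI)
  fix n K :: nat and \<alpha> :: real and r v :: "nat \<Rightarrow> real" and q
  assume inst: "instance_data n K \<alpha> r v" and q: "BMS_feasible n K \<alpha> v q"
  show "rescaled_feasible n K \<alpha> v (rescaled_sales n K v q)"
    using inst q rescaled_feasible_rescaled_sales
    by (auto simp: instance_data_def BMS_feasible_def)
  show "rescaled_objective n r (rescaled_sales n K v q) = revenue n K r v q"
    using inst q rescaled_objective_rescaled_sales
    by (auto simp: instance_data_def BMS_feasible_def)
next
  fix n K :: nat and \<alpha> :: real and r v w :: "nat \<Rightarrow> real"
  assume inst: "instance_data n K \<alpha> r v" and w: "rescaled_feasible n K \<alpha> v w"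
  then have pos: "1 \<le> n" "0 < \<alpha>" "\<forall>i\<in>{1..n}. 0 < v i" "balanced n \<alpha> w"
    by (auto simp: instance_data_def rescaled_feasible_def)
  from exists_implementing_policy[OF pos(1,3) w] obtain q
    where q: "is_policy n K q" "implements n K v q w" by blast
  have "revenue n K r v q = rescaled_objective n r w"
    using rescaled_objective_rescaled_sales[OF pos(3) q(1)]
      implements_imp_rescaled_objective_eq[OF q(2)] by simp
  then show "\<exists>q. BMS_feasible n K \<alpha> v q \<and> implements n K v q w \<and>
      revenue n K r v q = rescaled_objective n r w"
    using implements_imp_BMS_feasible[OF pos(1-3) q pos(4)] q(2) by blast
next
  show "\<exists>C::nat. \<forall>(n::nat) (K::nat) (\<alpha>::real) (r::nat \<Rightarrow> real) (v::nat \<Rightarrow> real) (w::nat \<Rightarrow> real).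
      instance_data n K \<alpha> r v \<longrightarrow>
      \<alpha> \<in> \<rat> \<longrightarrow> (\<forall>i\<in>{1..n}. r i \<in> \<rat> \<and> v i \<in> \<rat>) \<longrightarrow>
      rescaled_feasible n K \<alpha> v w \<longrightarrow> (\<forall>i\<in>{1..n}. w i \<in> \<rat>) \<longrightarrow>
        (\<exists>q. is_policy n K q \<and> implements n K v q w \<and>
             (\<forall>S. pmf q S \<in> \<rat>) \<and> card (set_pmf q) \<le> C * n)"
  \<comment> \<open>The support bound \<open>n + 1\<close> is at most \<open>2 * n\<close> because
    \<open>n\<close> is at least one.\<close>
  proof (intro exI[of _ 2] allI impI)
    fix n K :: nat and \<alpha> :: real and r v w :: "nat \<Rightarrow> real"
    assume inst: "instance_data n K \<alpha> r v" and w: "rescaled_feasible n K \<alpha> v w"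
      and rat: "\<forall>i\<in>{1..n}. r i \<in> \<rat> \<and> v i \<in> \<rat>" "\<forall>i\<in>{1..n}. w i \<in> \<rat>"
    have pos: "1 \<le> n" "\<forall>i\<in>{1..n}. 0 < v i" using inst by (auto simp: instance_data_def)
    from exists_implementing_policy[OF pos w] rat obtain q
      where "is_policy n K q" "implements n K v q w" "card (set_pmf q) \<le> n + 1" "\<forall>S. pmf q S \<in> \<rat>"
      by blast
    moreover have "n + 1 \<le> 2 * n" using pos by simp
    ultimately show "\<exists>q. is_policy n K q \<and> implements n K v q w \<and>
        (\<forall>S. pmf q S \<in> \<rat>) \<and> card (set_pmf q) \<le> 2 * n"
      using order_trans by blast
  qed
qed

end
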